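(* For every integer $n\ge 3$, $m(n,n-1)\ge \lg n$.
   Context: A hypergraph is an ordered pair $(X,H)$ such that $X$ is a set and $H$ is a family of subsets of $X$; elements of $X$ are its vertices and members of $H$ are its edges (edges may have arbitrary sizes). For any two distinct vertices $u,v$ of a hypergraph $(X,H)$, the line $\overline{uv}$ is the set $\{u,v\}\cup\{p\in X:\ \exists\, T\in H \text{ with } \{u,v,p\}\subseteq T\}$. The lines of the hypergraph are all the sets $\overline{uv}$ with $u,v$ distinct vertices; the number of lines is the number of distinct such sets. For integers $n,k$, $m(n,k)$ denotes the smallest number of (distinct) lines in a hypergraph on $n$ vertices where every line consists of at most $k$ vertices. $\lg$ denotes the logarithm to base $2$. *)

theory Defs
  imports Complex_Main
begin

definition hypergraph :: "'a set \<Rightarrow> 'a set set \<Rightarrow> bool" where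
  "hypergraph X H \<longleftrightarrow> (\<forall>T\<in>H. T \<subseteq> X)"

definition line :: "'a set \<Rightarrow> 'a set set \<Rightarrow> 'a \<Rightarrow> 'a \<Rightarrow> 'a set" where
  "line X H u v = {u, v} \<union> {p \<in> X. \<exists>T\<in>H. {u, v, p} \<subseteq> T}"

definition lines :: "'a set \<Rightarrow> 'a set set \<Rightarrow> 'a set set" where
  "lines X H = {line X H u v | u v. u \<in> X \<and> v \<in> X \<and> u \<noteq> v}"

(* The possible numbers of lines. Vertices are drawn from nat; this is no restriction,
   see line_counts_any_type below. *)
definition line_counts :: "nat \<Rightarrow> nat \<Rightarrow> nat set" where
  "line_counts n k = {card (lines X H) | (X :: nat set) H.
     finite X \<and> card X = n \<and> hypergraph X H \<and> (\<forall>L \<in> lines X H. card L \<le> k)}"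

(* If no hypergraph qualifies (e.g. n = 2, k = 1), the value is the arbitrary Inf {} = 0. *)
definition m :: "nat \<Rightarrow> nat \<Rightarrow> nat" where
  "m n k = Inf (line_counts n k)"

lemma line_counts_nonempty:
  assumes "2 \<le> k"
  shows "line_counts n k \<noteq> {}"
proof -
  have "card L \<le> k" if "L \<in> lines {..<n} {}" for L
    using that assms by (auto simp: lines_def line_def)
  then have "card (lines {..<n} {}) \<in> line_counts n k"
    unfolding line_counts_def hypergraph_def by (intro CollectI exI[of _ "{..<n}"] exI[of _ "{}"]) auto
  then show ?thesis by blast
qed

lemma m_attained:
  assumes "2 \<le> k"
  shows "m n k \<in> line_counts n k"
  unfolding m_def using line_counts_nonempty[OF assms] by (rule Inf_nat_def1)

lemma line_counts_any_type:
  fixes X :: "'a set"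
  assumes fin: "finite X" and n: "card X = n" and hyp: "hypergraph X H"
    and le: "\<And>L. L \<in> lines X H \<Longrightarrow> card L \<le> k"
  shows "card (lines X H) \<in> line_counts n k"
proof -
  obtain f :: "'a \<Rightarrow> nat" where f: "inj_on f X"
    using finite_imp_inj_to_nat_seg[OF fin] by blast
  let ?Y = "f ` X" and ?G = "(\<lambda>T. f ` T) ` H"
  have HX: "T \<subseteq> X" if "T \<in> H" for T
    using hyp that by (auto simp: hypergraph_def)
  have mem: "f x \<in> f ` T \<longleftrightarrow> x \<in> T" if "x \<in> X" "T \<in> H" for x T
    using inj_on_image_mem_iff[OF f that(1) HX[OF that(2)]] .
  have line_eq: "line ?Y ?G (f u) (f v) = f ` line X H u v" if "u \<in> X" "v \<in> X" for u v
  proof -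
    have "{p \<in> ?Y. \<exists>T\<in>?G. {f u, f v, p} \<subseteq> T} = f ` {p \<in> X. \<exists>T\<in>H. {u, v, p} \<subseteq> T}"
      using that HX by (auto simp: mem)
    then show ?thesis unfolding line_def by (simp add: image_Un)
  qed
  have lines_eq: "lines ?Y ?G = (\<lambda>L. f ` L) ` lines X H"
  proof
    show "lines ?Y ?G \<subseteq> (\<lambda>L. f ` L) ` lines X H"
      unfolding lines_def using line_eq by fastforce
    show "(\<lambda>L. f ` L) ` lines X H \<subseteq> lines ?Y ?G"
      unfolding lines_def using line_eq f by (fastforce simp: inj_on_eq_iff)
  qed
  have sub: "L \<subseteq> X" if "L \<in> lines X H" for L
    using that by (auto simp: lines_def line_def)
  have "inj_on (\<lambda>L. f ` L) (lines X H)"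
    using sub f by (meson inj_onI inj_on_image_eq_iff)
  then have "card (lines ?Y ?G) = card (lines X H)"
    by (simp add: lines_eq card_image)
  moreover have "hypergraph ?Y ?G"
    using HX by (auto simp: hypergraph_def)
  moreover have "card L \<le> k" if L: "L \<in> lines ?Y ?G" for L
  proof -
    obtain K where K: "K \<in> lines X H" "L = f ` K" using L unfolding lines_eq by auto
    then show ?thesis using le[OF K(1)] inj_on_subset[OF f sub[OF K(1)]] by (simp add: card_image)
  qed
  moreover have "card ?Y = n" using f n by (simp add: card_image)
  ultimately show ?thesis
    unfolding line_counts_def using fin by (intro CollectI exI[of _ ?Y] exI[of _ ?G]) auto
qed

end

(* If no line is the whole vertex set, a vertex is determined by the set of lines through it:
   given vertices x and y, pick z off the line xy; then no edge contains x, y and z,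
   so the line xz contains x but not y. Hence n vertices need at least lg n lines. *)
theory Submission imports Defs begin

lemma finite_lines:
  assumes "finite X"
  shows "finite (lines X H)"
  by (rule finite_subset[of _ "Pow X"]) (use assms in \<open>auto simp: lines_def line_def\<close>)

lemma inj_on_lines_through:
  assumes "X \<notin> lines X H"
  shows "inj_on (\<lambda>x. {L \<in> lines X H. x \<in> L}) X"
proof (rule inj_onI, rule ccontr)
  fix x y
  assume x: "x \<in> X" and y: "y \<in> X" and "x \<noteq> y"
    and eq: "{L \<in> lines X H. x \<in> L} = {L \<in> lines X H. y \<in> L}"
  then have "line X H x y \<in> lines X H"
    unfolding lines_def by blast
  with assms have "line X H x y \<noteq> X" by metis
  moreover have "line X H x y \<subseteq> X"
    using x y by (auto simp: line_def)
  ultimately obtain z where z: "z \<in> X" "z \<notin> line X H x y" by blast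
  then have "x \<noteq> z" by (auto simp: line_def)
  with x z(1) have "line X H x z \<in> lines X H"
    unfolding lines_def by blast
  moreover have "x \<in> line X H x z" by (simp add: line_def)
  \<comment> \<open>Here \<open>y\<close> differs from \<open>z\<close> because
    \<open>line X H x y\<close> contains \<open>y\<close> but misses \<open>z\<close>; an edge
    through \<open>x\<close>, \<open>z\<close> and \<open>y\<close> would put \<open>z\<close> on
    that line.\<close>
  moreover have "y \<notin> line X H x z"
    using z \<open>x \<noteq> y\<close> by (auto simp: line_def)
  ultimately show False using eq by blast
qed

text \<open>Sending each vertex to the set of lines through it injects \<open>X\<close> into the
  power set of the lines.\<close>

lemma card_le_two_power_card_lines:
  assumes "finite X" and "X \<notin> lines X H"
  shows "card X \<le> 2 ^ card (lines X H)"
proof -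
  have "card X \<le> card (Pow (lines X H))"
    by (rule card_inj_on_le[OF inj_on_lines_through[OF assms(2)]])
      (use finite_lines[OF assms(1)] in auto)
  then show ?thesis
    by (simp add: card_Pow finite_lines[OF assms(1)])
qed

theorem theorem4:
  fixes n :: nat
  assumes "n \<ge> 3"
  shows "real (m n (n - 1)) \<ge> log 2 (real n)"
proof -
  \<comment> \<open>From \<open>n \<ge> 3\<close> comes \<open>2 \<le> n - 1\<close>, so the infimum
    is attained and is not the default value of \<open>Inf {}\<close>.\<close>
  have "m n (n - 1) \<in> line_counts n (n - 1)"
    using assms by (intro m_attained) simp
  then obtain X :: "nat set" and H where X: "finite X" "card X = n"
    and le: "\<forall>L \<in> lines X H. card L \<le> n - 1" and m: "m n (n - 1) = card (lines X H)"
    unfolding line_counts_def by blast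
  \<comment> \<open>As a line, \<open>X\<close> would have at most \<open>n - 1\<close> points;
    since \<open>n\<close> is positive, the subtraction does not truncate and this is less than
    \<open>n\<close>.\<close>
  have "X \<notin> lines X H"
    using le X(2) assms by fastforce
  then have "n \<le> 2 ^ m n (n - 1)"
    using card_le_two_power_card_lines[OF X(1)] X(2) m by metis
  then have "real n \<le> 2 ^ m n (n - 1)"
    by (metis of_nat_le_iff of_nat_numeral of_nat_power)
  then show ?thesis
    using assms by (simp add: log_le_iff powr_realpow)
qed

end
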